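(* Let $\xi=(L^\xi,\Delta_0^\xi,B^\xi,d,G)$ be a generic configuration. If $\xi$ is 0-stable, then $B^\xi+\mathrm{SelfCons}^0(B^\xi,d)$ (with deduction method $d$) is self-justifying. (This result applies also when $\xi$ is E-stable or A-stable.)
   Context: **Generic configurations.** Standard-M is the standard model of the natural numbers. $\mathrm{Log}$ is the base-2 logarithm. A generic configuration $\xi$ is a 5-tuple $(L^\xi,\Delta_0^\xi,B^\xi,d,G)$ where: (1) $L^\xi$ is a language with symbols for $0,1,2,=,\le$ and $\mathrm{Maximum}(x,y)$, and enough function and constant symbols that every integer $k$ is the value of some term $T_k$. (2) $\Delta_0^\xi$ is a fixed class of fully bounded $L^\xi$-formulas (all quantifiers have the form $\exists v\le T$ or $\forall v\le T$ with $T$ a term), closed under negation, and rich enough to contain two formulas $\mathrm{Add}(x,y,z)$ and $\mathrm{Mult}(x,y,z)$ defining the graphs of addition and multiplication. Every $\Delta_0^\xi$ formula is both $\Pi_0^\xi$ and $\Sigma_0^\xi$; for $n\ge1$ a formula is $\Pi_n^\xi$ (resp. $\Sigma_n^\xi$) iff it can be written $\forall v_1\cdots\forall v_k\,\Phi$ with $\Phi\in\Sigma_{n-1}^\xi$ (resp. $\exists v_1\cdots\exists v_k\,\Phi$ with $\Phi\in\Pi_{n-1}^\xi$); $\Delta_0^\xi$ sentences count as both $\Pi_1^\xi$ and $\Sigma_1^\xi$. (3) $B^\xi$ (the base axiom system) is an axiom system whose axioms are true in Standard-M and which is $\Sigma_1^\xi$-complete: it proves every true $\Sigma_1^\xi$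 sentence and refutes every false $\Pi_1^\xi$ sentence. (4) $d$ is a deduction method, conventional enough to satisfy the indirect-implication property associated with Gödel's Completeness Theorem: whether or not modus ponens is built in, whenever it can prove $X$, $Y$ and $(X\wedge Y)\to Z$, it can prove $Z$ (possibly by a much longer proof). (5) $G$ is a method for encoding the Gödel numbers of proofs. Proofs are identified with their Gödel numbers $p$. **Goodness.** $E(N)$ is a term of value $2^N$. For a prenex sentence $\Upsilon$, $\mathrm{Scope}_E(\Upsilon,N)$ is obtained from $\Upsilon$ by replacing each unbounded $\forall v$ by $\forall v<E(N)$ and each unbounded $\exists v$ by $\exists v<E(N)$, leaving the bounded quantifiers of the $\Delta_0^\xi$ part unchanged. A $\Pi_1^\xi$ or $\Sigma_1^\xi$ sentence $\Upsilon$ is $\mathrm{Good}(N)$ when $\mathrm{Scope}_E(\Upsilon,N)$ is true in Standard-M ($\mathrm{Good}(\infty)$ means true in Standard-M). For a set $\theta$ of $\Pi_1^\xi$ sentences, $\sharp(\theta)$ is the largest integer $J$ such that every sentence of $\theta$ is $\mathrm{Good}(J)$, and $\sharp(\theta)=\infty$ if this holds for all $J$. **Stability.** $\mathrm{RE\text{-}Class}(\xi)$ is the set of all recursively enumerable sets $\theta$ of $\Pi_1^\xi$ sentences (true or not). - $\xi$ is A-stable iff for every $\theta\in\mathrm{RE\text{-}Class}(\xi)$: if $\Upsilon$ is a $\Pi_1^\xi$ theorem of $\theta\cup B^\xi$ via a proof $p$ with $\mathrm{Log}(p)\le\sharp(\theta)+1$, then $\Upsilon$ is $\mathrm{Good}\{\tfrac12\sharp(\theta)\}$.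 - $\xi$ is E-stable iff for every $\theta\in\mathrm{RE\text{-}Class}(\xi)$: if $\Upsilon$ is a $\Sigma_1^\xi$ theorem of $\theta\cup B^\xi$ via a proof $p$ with $\mathrm{Log}(p)\le\sharp(\theta)+1$, then $\Upsilon$ is $\mathrm{Good}\{\tfrac12\lfloor\mathrm{Log}(p)\rfloor-1\}$. - $\xi$ is 0-stable iff for every $\theta\in\mathrm{RE\text{-}Class}(\xi)$: if $\Upsilon$ is a $\Delta_0^\xi$ theorem of $\theta\cup B^\xi$ via a proof $p$ with $\mathrm{Log}(p)\le\sharp(\theta)+1$, then $\Upsilon$ is true in Standard-M. **Self-consistency axioms.** An axiom system $\alpha\supseteq B^\xi$ is Level$(k^\xi)$ consistent when there are no proofs from $\alpha$ via $d$ of both a $\Pi_k^\xi$ sentence and the $\Sigma_k^\xi$ sentence that is its negation. For $\beta\supseteq B^\xi$, $\mathrm{SelfCons}^k(\beta,d)$ is a self-referencing $\Pi_1^\xi$ sentence asserting the Level$(k^\xi)$ consistency of $\beta+\mathrm{SelfCons}^k(\beta,d)$. Explicitly, use $\Delta_0^\xi$ formulas: $\mathrm{Neg}^k(x,y)$: $x$ is the Gödel number of a $\Pi_k^\xi$ sentence and $y$ that of the $\Sigma_k^\xi$ sentence which is its negation; $\mathrm{SubstPrf}^d_\beta(g,t,p)$: there is $h$ such that $h$ encodes the sentence obtained from the formula with code $g$ by replacing its free variables by the numeral $\bar g$, and $p$ is a proof of $t$ via $d$ from $\beta$ together with the sentence coded by $h$. Let $\Gamma^k(g)$ be $\forall x\forall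 y\forall p\forall q\ \neg\{\mathrm{Neg}^k(x,y)\wedge\mathrm{SubstPrf}^d_\beta(g,x,p)\wedge\mathrm{SubstPrf}^d_\beta(g,y,q)\}$ and $n$ its Gödel number; then $\mathrm{SelfCons}^k(\beta,d)$ is $\Gamma^k(\bar n)$. **Self-justification.** A pair $(\alpha,d)$ (axiom system, deduction method) is self-justifying when (i) one of $\alpha$'s theorems states that $d$, applied to $\alpha$, produces a consistent set of theorems, and (ii) $\alpha$ is in fact consistent. *)

theory Defs
  imports Complex_Main "HOL-Library.Extended_Real"
begin

section \<open>Syntax\<close>

text \<open>
  First-order formulas over function symbols \<open>'f\<close> and relation symbols \<open>'r\<close>, with de Bruijn
  indices.  Equality and \<open>\<le>\<close> belong to every language.  The bounded quantifiers
  \<open>\<forall>v\<le>t\<close> and \<open>\<exists>v\<le>t\<close> are separate constructors, so that the unbounded quantifiers of a formula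
  can be read off its syntax; the bounding term \<open>t\<close> lies outside the scope of the quantifier.
\<close>

datatype 'f trm = Var nat | Fn 'f "'f trm list"

datatype ('f, 'r) fm =
    Eq "'f trm" "'f trm"
  | Le "'f trm" "'f trm"
  | Rel 'r "'f trm list"
  | Neg "('f, 'r) fm"
  | And "('f, 'r) fm" "('f, 'r) fm"
  | Or "('f, 'r) fm" "('f, 'r) fm"
  | Imp "('f, 'r) fm" "('f, 'r) fm"
  | Forall "('f, 'r) fm"
  | Exists "('f, 'r) fm"
  | BForall "'f trm" "('f, 'r) fm"
  | BExists "'f trm" "('f, 'r) fm"

primrec fv_trm :: "'f trm \<Rightarrow> nat set" where
  "fv_trm (Var i) = {i}"
| "fv_trm (Fn f ts) = \<Union> (set (map fv_trm ts))"

primrec fv :: "('f, 'r) fm \<Rightarrow> nat set" where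
  "fv (Eq s t) = fv_trm s \<union> fv_trm t"
| "fv (Le s t) = fv_trm s \<union> fv_trm t"
| "fv (Rel r ts) = (\<Union>t\<in>set ts. fv_trm t)"
| "fv (Neg a) = fv a"
| "fv (And a b) = fv a \<union> fv b"
| "fv (Or a b) = fv a \<union> fv b"
| "fv (Imp a b) = fv a \<union> fv b"
| "fv (Forall a) = {i. Suc i \<in> fv a}"
| "fv (Exists a) = {i. Suc i \<in> fv a}"
| "fv (BForall t a) = fv_trm t \<union> {i. Suc i \<in> fv a}"
| "fv (BExists t a) = fv_trm t \<union> {i. Suc i \<in> fv a}"

primrec fully_bounded :: "('f, 'r) fm \<Rightarrow> bool" where
  "fully_bounded (Eq s t) = True"
| "fully_bounded (Le s t) = True"
| "fully_bounded (Rel r ts) = True"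
| "fully_bounded (Neg a) = fully_bounded a"
| "fully_bounded (And a b) = (fully_bounded a \<and> fully_bounded b)"
| "fully_bounded (Or a b) = (fully_bounded a \<and> fully_bounded b)"
| "fully_bounded (Imp a b) = (fully_bounded a \<and> fully_bounded b)"
| "fully_bounded (Forall a) = False"
| "fully_bounded (Exists a) = False"
| "fully_bounded (BForall t a) = fully_bounded a"
| "fully_bounded (BExists t a) = fully_bounded a"

primrec subst_trm :: "(nat \<Rightarrow> 'f trm) \<Rightarrow> 'f trm \<Rightarrow> 'f trm" where
  "subst_trm \<sigma> (Var i) = \<sigma> i"
| "subst_trm \<sigma> (Fn f ts) = Fn f (map (subst_trm \<sigma>) ts)"

definition lift_trm :: "'f trm \<Rightarrow> 'f trm" where
  "lift_trm t = subst_trm (\<lambda>i. Var (Suc i)) t"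

definition push :: "(nat \<Rightarrow> 'f trm) \<Rightarrow> nat \<Rightarrow> 'f trm" where
  "push \<sigma> = case_nat (Var 0) (\<lambda>i. lift_trm (\<sigma> i))"

primrec subst :: "(nat \<Rightarrow> 'f trm) \<Rightarrow> ('f, 'r) fm \<Rightarrow> ('f, 'r) fm" where
  "subst \<sigma> (Eq s t) = Eq (subst_trm \<sigma> s) (subst_trm \<sigma> t)"
| "subst \<sigma> (Le s t) = Le (subst_trm \<sigma> s) (subst_trm \<sigma> t)"
| "subst \<sigma> (Rel r ts) = Rel r (map (subst_trm \<sigma>) ts)"
| "subst \<sigma> (Neg a) = Neg (subst \<sigma> a)"
| "subst \<sigma> (And a b) = And (subst \<sigma> a) (subst \<sigma> b)"
| "subst \<sigma> (Or a b) = Or (subst \<sigma> a) (subst \<sigma> b)"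
| "subst \<sigma> (Imp a b) = Imp (subst \<sigma> a) (subst \<sigma> b)"
| "subst \<sigma> (Forall a) = Forall (subst (push \<sigma>) a)"
| "subst \<sigma> (Exists a) = Exists (subst (push \<sigma>) a)"
| "subst \<sigma> (BForall t a) = BForall (subst_trm \<sigma> t) (subst (push \<sigma>) a)"
| "subst \<sigma> (BExists t a) = BExists (subst_trm \<sigma> t) (subst (push \<sigma>) a)"

text \<open>\<open>inst a [t\<^sub>0, \<dots>, t\<^sub>m]\<close> is the formula \<open>a(t\<^sub>0, \<dots>, t\<^sub>m)\<close>, for \<open>a\<close> with free variables
  among \<open>0, \<dots>, m\<close>.\<close>

definition inst :: "('f, 'r) fm \<Rightarrow> 'f trm list \<Rightarrow> ('f, 'r) fm" where
  "inst a ts = subst (\<lambda>i. if i < length ts then ts ! i else Var i) a"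

text \<open>The prenex form of the negation: it carries a \<open>\<Pi>\<^sub>k\<close> sentence to a \<open>\<Sigma>\<^sub>k\<close> sentence, and
  a fully bounded formula \<open>a\<close> to \<open>Neg a\<close>.\<close>

fun prenex_neg :: "('f, 'r) fm \<Rightarrow> ('f, 'r) fm" where
  "prenex_neg (Forall a) = Exists (prenex_neg a)"
| "prenex_neg (Exists a) = Forall (prenex_neg a)"
| "prenex_neg a = Neg a"


section \<open>Recursively enumerable sets\<close>

datatype recf = Zero | Succ | Proj nat | Comp recf "recf list" | PRec recf recf | Mu recf

inductive rec_eval :: "recf \<Rightarrow> nat list \<Rightarrow> nat \<Rightarrow> bool" where
  "rec_eval Zero xs 0"
| "rec_eval Succ [x] (Suc x)"
| "i < length xs \<Longrightarrow> rec_eval (Proj i) xs (xs ! i)"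
| "list_all2 (\<lambda>g y. rec_eval g xs y) gs ys \<Longrightarrow> rec_eval f ys z \<Longrightarrow> rec_eval (Comp f gs) xs z"
| "rec_eval f xs y \<Longrightarrow> rec_eval (PRec f g) (0 # xs) y"
| "rec_eval (PRec f g) (n # xs) y \<Longrightarrow> rec_eval g (n # y # xs) z
    \<Longrightarrow> rec_eval (PRec f g) (Suc n # xs) z"
| "rec_eval f (n # xs) 0 \<Longrightarrow> (\<forall>m<n. \<exists>y. rec_eval f (m # xs) (Suc y)) \<Longrightarrow> rec_eval (Mu f) xs n"

text \<open>The recursively enumerable sets are the ranges of the unary partial recursive functions.\<close>

definition rec_enumerable :: "nat set \<Rightarrow> bool" where
  "rec_enumerable A \<longleftrightarrow> (\<exists>f. A = {y. \<exists>x. rec_eval f [x] y})"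


section \<open>Generic configurations\<close>

text \<open>
  The fields down to \<open>numeral\<close> describe the language \<open>L\<close> together with the interpretation of its
  symbols in the standard model, whose universe is \<open>nat\<close>; \<open>numeral k\<close> is the term \<open>T\<^sub>k\<close>.
  The type \<open>'p\<close> is that of the proofs: \<open>ded A X \<pi>\<close> says that \<open>\<pi>\<close> is a proof of \<open>X\<close> from the
  axioms \<open>A\<close>.  The method \<open>G\<close> consists of the last two fields, the Goedel numberings of formulas
  and of proofs.
\<close>

record ('f, 'r, 'p) config =
  fun_arity :: "'f \<Rightarrow> nat"
  rel_arity :: "'r \<Rightarrow> nat"
  fun_interp :: "'f \<Rightarrow> nat list \<Rightarrow> nat"
  rel_interp :: "'r \<Rightarrow> nat list \<Rightarrow> bool"
  zero_sym :: 'f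
  one_sym :: 'f
  two_sym :: 'f
  max_sym :: 'f
  numeral :: "nat \<Rightarrow> 'f trm"
  Delta0 :: "('f, 'r) fm set"
  base :: "('f, 'r) fm set"
  ded :: "('f, 'r) fm set \<Rightarrow> ('f, 'r) fm \<Rightarrow> 'p \<Rightarrow> bool"
  code_fm :: "('f, 'r) fm \<Rightarrow> nat"
  code_prf :: "'p \<Rightarrow> nat"

primrec wf_trm :: "('f, 'r, 'p) config \<Rightarrow> 'f trm \<Rightarrow> bool" where
  "wf_trm \<xi> (Var i) = True"
| "wf_trm \<xi> (Fn f ts) = (length ts = fun_arity \<xi> f \<and> list_all (wf_trm \<xi>) ts)"

primrec wf_fm :: "('f, 'r, 'p) config \<Rightarrow> ('f, 'r) fm \<Rightarrow> bool" where
  "wf_fm \<xi> (Eq s t) = (wf_trm \<xi> s \<and> wf_trm \<xi> t)"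
| "wf_fm \<xi> (Le s t) = (wf_trm \<xi> s \<and> wf_trm \<xi> t)"
| "wf_fm \<xi> (Rel r ts) = (length ts = rel_arity \<xi> r \<and> list_all (wf_trm \<xi>) ts)"
| "wf_fm \<xi> (Neg a) = wf_fm \<xi> a"
| "wf_fm \<xi> (And a b) = (wf_fm \<xi> a \<and> wf_fm \<xi> b)"
| "wf_fm \<xi> (Or a b) = (wf_fm \<xi> a \<and> wf_fm \<xi> b)"
| "wf_fm \<xi> (Imp a b) = (wf_fm \<xi> a \<and> wf_fm \<xi> b)"
| "wf_fm \<xi> (Forall a) = wf_fm \<xi> a"
| "wf_fm \<xi> (Exists a) = wf_fm \<xi> a"
| "wf_fm \<xi> (BForall t a) = (wf_trm \<xi> t \<and> wf_fm \<xi> a)"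
| "wf_fm \<xi> (BExists t a) = (wf_trm \<xi> t \<and> wf_fm \<xi> a)"

definition sentence :: "('f, 'r, 'p) config \<Rightarrow> ('f, 'r) fm \<Rightarrow> bool" where
  "sentence \<xi> X \<longleftrightarrow> wf_fm \<xi> X \<and> fv X = {}"

primrec val :: "('f, 'r, 'p) config \<Rightarrow> (nat \<Rightarrow> nat) \<Rightarrow> 'f trm \<Rightarrow> nat" where
  "val \<xi> e (Var i) = e i"
| "val \<xi> e (Fn f ts) = fun_interp \<xi> f (map (val \<xi> e) ts)"

primrec sat :: "('f, 'r, 'p) config \<Rightarrow> (nat \<Rightarrow> nat) \<Rightarrow> ('f, 'r) fm \<Rightarrow> bool" where
  "sat \<xi> e (Eq s t) = (val \<xi> e s = val \<xi> e t)"
| "sat \<xi> e (Le s t) = (val \<xi> e s \<le> val \<xi> e t)"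
| "sat \<xi> e (Rel r ts) = rel_interp \<xi> r (map (val \<xi> e) ts)"
| "sat \<xi> e (Neg a) = (\<not> sat \<xi> e a)"
| "sat \<xi> e (And a b) = (sat \<xi> e a \<and> sat \<xi> e b)"
| "sat \<xi> e (Or a b) = (sat \<xi> e a \<or> sat \<xi> e b)"
| "sat \<xi> e (Imp a b) = (sat \<xi> e a \<longrightarrow> sat \<xi> e b)"
| "sat \<xi> e (Forall a) = (\<forall>v. sat \<xi> (case_nat v e) a)"
| "sat \<xi> e (Exists a) = (\<exists>v. sat \<xi> (case_nat v e) a)"
| "sat \<xi> e (BForall t a) = (\<forall>v\<le>val \<xi> e t. sat \<xi> (case_nat v e) a)"
| "sat \<xi> e (BExists t a) = (\<exists>v\<le>val \<xi> e t. sat \<xi> (case_nat v e) a)"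

definition true_std :: "('f, 'r, 'p) config \<Rightarrow> ('f, 'r) fm \<Rightarrow> bool" where
  "true_std \<xi> X \<longleftrightarrow> (\<forall>e. sat \<xi> e X)"

definition defines2 ::
  "('f, 'r, 'p) config \<Rightarrow> ('f, 'r) fm \<Rightarrow> (nat \<Rightarrow> nat \<Rightarrow> bool) \<Rightarrow> bool" where
  "defines2 \<xi> a R \<longleftrightarrow> wf_fm \<xi> a \<and> fv a \<subseteq> {0, 1} \<and> (\<forall>e. sat \<xi> e a \<longleftrightarrow> R (e 0) (e 1))"

definition defines3 ::
  "('f, 'r, 'p) config \<Rightarrow> ('f, 'r) fm \<Rightarrow> (nat \<Rightarrow> nat \<Rightarrow> nat \<Rightarrow> bool) \<Rightarrow> bool" where
  "defines3 \<xi> a R \<longleftrightarrow> wf_fm \<xi> a \<and> fv a \<subseteq> {0, 1, 2} \<and> (\<forall>e. sat \<xi> e a \<longleftrightarrow> R (e 0) (e 1) (e 2))"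

fun Pi_class Sigma_class :: "('f, 'r, 'p) config \<Rightarrow> nat \<Rightarrow> ('f, 'r) fm set" where
  "Pi_class \<xi> 0 = Delta0 \<xi>"
| "Pi_class \<xi> (Suc n) = {(Forall ^^ k) a | k a. a \<in> Sigma_class \<xi> n}"
| "Sigma_class \<xi> 0 = Delta0 \<xi>"
| "Sigma_class \<xi> (Suc n) = {(Exists ^^ k) a | k a. a \<in> Pi_class \<xi> n}"

definition proof_of ::
  "('f, 'r, 'p) config \<Rightarrow> ('f, 'r) fm set \<Rightarrow> ('f, 'r) fm \<Rightarrow> nat \<Rightarrow> bool" where
  "proof_of \<xi> A X p \<longleftrightarrow> (\<exists>\<pi>. ded \<xi> A X \<pi> \<and> code_prf \<xi> \<pi> = p)"

definition provable :: "('f, 'r, 'p) config \<Rightarrow> ('f, 'r) fm set \<Rightarrow> ('f, 'r) fm \<Rightarrow> bool" where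
  "provable \<xi> A X \<longleftrightarrow> (\<exists>p. proof_of \<xi> A X p)"

definition language :: "('f, 'r, 'p) config \<Rightarrow> bool" where
  "language \<xi> \<longleftrightarrow>
     fun_arity \<xi> (zero_sym \<xi>) = 0 \<and> fun_interp \<xi> (zero_sym \<xi>) [] = 0 \<and>
     fun_arity \<xi> (one_sym \<xi>) = 0 \<and> fun_interp \<xi> (one_sym \<xi>) [] = 1 \<and>
     fun_arity \<xi> (two_sym \<xi>) = 0 \<and> fun_interp \<xi> (two_sym \<xi>) [] = 2 \<and>
     fun_arity \<xi> (max_sym \<xi>) = 2 \<and> (\<forall>x y. fun_interp \<xi> (max_sym \<xi>) [x, y] = max x y) \<and>
     (\<forall>k. wf_trm \<xi> (numeral \<xi> k) \<and> fv_trm (numeral \<xi> k) = {} \<and> (\<forall>e. val \<xi> e (numeral \<xi> k) = k))"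

definition Delta0_class :: "('f, 'r, 'p) config \<Rightarrow> bool" where
  "Delta0_class \<xi> \<longleftrightarrow>
     (\<forall>a\<in>Delta0 \<xi>. wf_fm \<xi> a \<and> fully_bounded a \<and> Neg a \<in> Delta0 \<xi>) \<and>
     (\<exists>a\<in>Delta0 \<xi>. defines3 \<xi> a (\<lambda>x y z. x + y = z)) \<and>
     (\<exists>a\<in>Delta0 \<xi>. defines3 \<xi> a (\<lambda>x y z. x * y = z))"

definition base_system :: "('f, 'r, 'p) config \<Rightarrow> bool" where
  "base_system \<xi> \<longleftrightarrow>
     (\<forall>X\<in>base \<xi>. sentence \<xi> X \<and> true_std \<xi> X) \<and>
     (\<forall>X\<in>Sigma_class \<xi> 1. sentence \<xi> X \<and> true_std \<xi> X \<longrightarrow> provable \<xi> (base \<xi>) X) \<and>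
     (\<forall>X\<in>Pi_class \<xi> 1. sentence \<xi> X \<and> \<not> true_std \<xi> X \<longrightarrow> provable \<xi> (base \<xi>) (Neg X))"

text \<open>
  Besides the indirect-implication property, a deduction method proves its axioms and is sound.
  Soundness is only required with respect to the standard model, which is less than
  first-order soundness; completeness is not required.
\<close>

definition deduction_method :: "('f, 'r, 'p) config \<Rightarrow> bool" where
  "deduction_method \<xi> \<longleftrightarrow>
     (\<forall>A. (\<forall>X\<in>A. sentence \<xi> X) \<longrightarrow>
       (\<forall>X\<in>A. provable \<xi> A X) \<and>
       (\<forall>X. sentence \<xi> X \<and> (\<forall>Y\<in>A. true_std \<xi> Y) \<and> provable \<xi> A X \<longrightarrow> true_std \<xi> X) \<and>
       (\<forall>X Y Z. sentence \<xi> X \<and> sentence \<xi> Y \<and> sentence \<xi> Z \<and>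
          provable \<xi> A X \<and> provable \<xi> A Y \<and> provable \<xi> A (Imp (And X Y) Z) \<longrightarrow> provable \<xi> A Z))"

definition encoding :: "('f, 'r, 'p) config \<Rightarrow> bool" where
  "encoding \<xi> \<longleftrightarrow> inj_on (code_fm \<xi>) {a. wf_fm \<xi> a} \<and> inj (code_prf \<xi>)"

definition generic_configuration :: "('f, 'r, 'p) config \<Rightarrow> bool" where
  "generic_configuration \<xi> \<longleftrightarrow>
     language \<xi> \<and> Delta0_class \<xi> \<and> base_system \<xi> \<and> deduction_method \<xi> \<and> encoding \<xi>"


section \<open>Goodness and stability\<close>

text \<open>\<open>scope t X\<close> relativises the leading unbounded quantifiers to \<open>v < t\<close>, which is expressed by
  the bounded quantifier \<open>v \<le> t\<close> and the condition \<open>\<not> t \<le> v\<close>.\<close>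

fun scope :: "'f trm \<Rightarrow> ('f, 'r) fm \<Rightarrow> ('f, 'r) fm" where
  "scope t (Forall a) =
     BForall t (Imp (Neg (Le (lift_trm t) (Var 0))) (scope (lift_trm t) a))"
| "scope t (Exists a) =
     BExists t (And (Neg (Le (lift_trm t) (Var 0))) (scope (lift_trm t) a))"
| "scope t a = a"

text \<open>
  The stability conditions use \<open>Good(N)\<close> for fractional and negative \<open>N\<close> as well.  For a natural
  number \<open>v\<close>, \<open>v < 2\<^sup>N\<close> is equivalent to \<open>v < \<lceil>2\<^sup>N\<rceil>\<close>, so \<open>E(N)\<close> is a term of value
  \<open>\<lceil>2\<^sup>N\<rceil>\<close>, which is \<open>2\<^sup>N\<close> when \<open>N\<close> is a natural number.
\<close>

definition E_term :: "('f, 'r, 'p) config \<Rightarrow> real \<Rightarrow> 'f trm" where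
  "E_term \<xi> N = numeral \<xi> (nat \<lceil>2 powr N\<rceil>)"

definition good :: "('f, 'r, 'p) config \<Rightarrow> ereal \<Rightarrow> ('f, 'r) fm \<Rightarrow> bool" where
  "good \<xi> N X = (case N of
       ereal r \<Rightarrow> true_std \<xi> (scope (E_term \<xi> r) X)
     | PInfty \<Rightarrow> true_std \<xi> X
     | MInfty \<Rightarrow> true_std \<xi> (scope (numeral \<xi> 0) X))"

text \<open>
  The set below is downward closed, so its supremum is its largest element, or \<open>\<infinity>\<close> when it
  contains all integers.  It may be empty, since a false \<open>\<Delta>\<^sub>0\<close> sentence is not \<open>Good(J)\<close> for any
  \<open>J\<close>; then \<open>sharp \<xi> \<theta> = - \<infinity>\<close>, and no proof \<open>p\<close> satisfies \<open>Log(p) \<le> sharp \<xi> \<theta> + 1\<close>.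
\<close>

definition sharp :: "('f, 'r, 'p) config \<Rightarrow> ('f, 'r) fm set \<Rightarrow> ereal" where
  "sharp \<xi> \<theta> = Sup {ereal (of_int J) | J :: int. \<forall>X\<in>\<theta>. good \<xi> (ereal (of_int J)) X}"

definition RE_Class :: "('f, 'r, 'p) config \<Rightarrow> ('f, 'r) fm set set" where
  "RE_Class \<xi> = {\<theta>. (\<forall>X\<in>\<theta>. X \<in> Pi_class \<xi> 1 \<and> sentence \<xi> X) \<and> rec_enumerable (code_fm \<xi> ` \<theta>)}"

definition A_stable :: "('f, 'r, 'p) config \<Rightarrow> bool" where
  "A_stable \<xi> \<longleftrightarrow> (\<forall>\<theta>\<in>RE_Class \<xi>. \<forall>X\<in>Pi_class \<xi> 1. \<forall>p.
     sentence \<xi> X \<and> proof_of \<xi> (\<theta> \<union> base \<xi>) X p \<and> ereal (log 2 (real p)) \<le> sharp \<xi> \<theta> + 1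
     \<longrightarrow> good \<xi> (sharp \<xi> \<theta> / 2) X)"

definition E_stable :: "('f, 'r, 'p) config \<Rightarrow> bool" where
  "E_stable \<xi> \<longleftrightarrow> (\<forall>\<theta>\<in>RE_Class \<xi>. \<forall>X\<in>Sigma_class \<xi> 1. \<forall>p.
     sentence \<xi> X \<and> proof_of \<xi> (\<theta> \<union> base \<xi>) X p \<and> ereal (log 2 (real p)) \<le> sharp \<xi> \<theta> + 1
     \<longrightarrow> good \<xi> (ereal (of_int \<lfloor>log 2 (real p)\<rfloor> / 2 - 1)) X)"

definition zero_stable :: "('f, 'r, 'p) config \<Rightarrow> bool" where
  "zero_stable \<xi> \<longleftrightarrow> (\<forall>\<theta>\<in>RE_Class \<xi>. \<forall>X\<in>Delta0 \<xi>. \<forall>p.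
     sentence \<xi> X \<and> proof_of \<xi> (\<theta> \<union> base \<xi>) X p \<and> ereal (log 2 (real p)) \<le> sharp \<xi> \<theta> + 1
     \<longrightarrow> true_std \<xi> X)"


section \<open>Self-consistency and self-justification\<close>

definition neg_pair :: "('f, 'r, 'p) config \<Rightarrow> nat \<Rightarrow> nat \<Rightarrow> nat \<Rightarrow> bool" where
  "neg_pair \<xi> k x y \<longleftrightarrow> (\<exists>X\<in>Pi_class \<xi> k. sentence \<xi> X \<and>
     x = code_fm \<xi> X \<and> y = code_fm \<xi> (prenex_neg X))"

definition prf_code :: "('f, 'r, 'p) config \<Rightarrow> ('f, 'r) fm set \<Rightarrow> nat \<Rightarrow> nat \<Rightarrow> bool" where
  "prf_code \<xi> A t p \<longleftrightarrow> (\<exists>X. sentence \<xi> X \<and> t = code_fm \<xi> X \<and> proof_of \<xi> A X p)"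

definition self_subst :: "('f, 'r, 'p) config \<Rightarrow> ('f, 'r) fm \<Rightarrow> ('f, 'r) fm" where
  "self_subst \<xi> a = subst (\<lambda>_. numeral \<xi> (code_fm \<xi> a)) a"

definition subst_prf ::
  "('f, 'r, 'p) config \<Rightarrow> ('f, 'r) fm set \<Rightarrow> nat \<Rightarrow> nat \<Rightarrow> nat \<Rightarrow> bool" where
  "subst_prf \<xi> \<beta> g t p \<longleftrightarrow>
     (\<exists>a. wf_fm \<xi> a \<and> g = code_fm \<xi> a \<and> prf_code \<xi> (\<beta> \<union> {self_subst \<xi> a}) t p)"

text \<open>
  \<open>\<Gamma>(g)\<close> for given formulas \<open>N(x, y)\<close> and \<open>P(g, t, p)\<close>.  The quantified variables \<open>x, y, p, q\<close>
  are the indices \<open>3, 2, 1, 0\<close>, and \<open>g\<close> is the index \<open>4\<close>, hence the free variable \<open>0\<close> of \<open>\<Gamma>\<close>.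
\<close>

definition Gamma_fm :: "('f, 'r) fm \<Rightarrow> ('f, 'r) fm \<Rightarrow> ('f, 'r) fm" where
  "Gamma_fm N P = Forall (Forall (Forall (Forall (Neg
     (And (inst N [Var 3, Var 2])
          (And (inst P [Var 4, Var 3, Var 1])
               (inst P [Var 4, Var 2, Var 0])))))))"

definition SelfCons :: "('f, 'r, 'p) config \<Rightarrow> ('f, 'r) fm \<Rightarrow> ('f, 'r) fm \<Rightarrow> ('f, 'r) fm" where
  "SelfCons \<xi> N P = inst (Gamma_fm N P) [numeral \<xi> (code_fm \<xi> (Gamma_fm N P))]"

text \<open>
  \<open>N\<close> and \<open>P\<close> can serve as the formulas \<open>Neg\<^sup>k\<close> and \<open>SubstPrf\<close> of \<open>SelfCons\<^sup>k(\<beta>, d)\<close>.  The last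
  condition is automatic when \<open>\<Delta>\<^sub>0\<close> is closed under conjunction and under substitution of terms,
  which generic configurations do not demand.
\<close>

definition selfcons_formulas ::
  "('f, 'r, 'p) config \<Rightarrow> nat \<Rightarrow> ('f, 'r) fm set \<Rightarrow> ('f, 'r) fm \<Rightarrow> ('f, 'r) fm \<Rightarrow> bool" where
  "selfcons_formulas \<xi> k \<beta> N P \<longleftrightarrow>
     N \<in> Delta0 \<xi> \<and> defines2 \<xi> N (neg_pair \<xi> k) \<and>
     P \<in> Delta0 \<xi> \<and> defines3 \<xi> P (subst_prf \<xi> \<beta>) \<and>
     SelfCons \<xi> N P \<in> Pi_class \<xi> 1"

definition consistent :: "('f, 'r, 'p) config \<Rightarrow> ('f, 'r) fm set \<Rightarrow> bool" where
  "consistent \<xi> A \<longleftrightarrow> \<not> (\<exists>X. sentence \<xi> X \<and> provable \<xi> A X \<and> provable \<xi> A (Neg X))"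

text \<open>
  What a sentence states is not determined by its truth value, so it is read off its syntax,
  relative to an arithmetization of \<open>(\<alpha>, d)\<close>: a formula \<open>N(x, y)\<close> for the pairs of a \<open>\<Pi>\<^sub>k\<close>
  sentence and its negation, and a formula \<open>Q(t, p)\<close> for the proofs from \<open>\<alpha>\<close>.
\<close>

definition states_consistency ::
  "('f, 'r, 'p) config \<Rightarrow> nat \<Rightarrow> ('f, 'r) fm \<Rightarrow> ('f, 'r) fm \<Rightarrow> ('f, 'r) fm set \<Rightarrow>
     ('f, 'r) fm \<Rightarrow> bool" where
  "states_consistency \<xi> k N Q \<alpha> S \<longleftrightarrow>
     defines2 \<xi> N (neg_pair \<xi> k) \<and> defines2 \<xi> Q (prf_code \<xi> \<alpha>) \<and>
     S = Forall (Forall (Forall (Forall (Neg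
       (And (inst N [Var 3, Var 2])
            (And (inst Q [Var 3, Var 1])
                 (inst Q [Var 2, Var 0])))))))"

definition self_justifying ::
  "('f, 'r, 'p) config \<Rightarrow> nat \<Rightarrow> ('f, 'r) fm \<Rightarrow> ('f, 'r) fm \<Rightarrow> ('f, 'r) fm set \<Rightarrow> bool" where
  "self_justifying \<xi> k N Q \<alpha> \<longleftrightarrow>
     (\<exists>S. provable \<xi> \<alpha> S \<and> states_consistency \<xi> k N Q \<alpha> S) \<and> consistent \<xi> \<alpha>"

end

theory Submission
  imports Defs
begin

text \<open>
  Suppose the self-consistency sentence \<open>S\<close> is false, and let \<open>(x, y, p, q)\<close> be a counterexample
  whose largest component \<open>m\<close> is least possible.  Then \<open>S\<close> is \<open>Good(\<lfloor>Log m\<rfloor>)\<close>, so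
  \<open>Log p, Log q \<le> Log m \<le> sharp {S} + 1\<close>, and stability applied to \<open>\<theta> = {S}\<close> makes both a
  \<open>\<Delta>\<^sub>0\<close> sentence and its negation true.  Hence \<open>S\<close> is true, and the system is consistent by
  soundness.  E-stability and A-stability suffice as well, since every degree of goodness of a
  \<open>\<Delta>\<^sub>0\<close> sentence amounts to its truth.
\<close>

section \<open>Substitution\<close>

lemma subst_trm_cong:
  "(\<And>i. i \<in> fv_trm t \<Longrightarrow> \<sigma> i = \<tau> i) \<Longrightarrow> subst_trm \<sigma> t = subst_trm \<tau> t"
  by (induction t) auto

lemma subst_cong:
  "(\<And>i. i \<in> fv a \<Longrightarrow> \<sigma> i = \<tau> i) \<Longrightarrow> subst \<sigma> a = subst \<tau> a"
proof (induction a arbitrary: \<sigma> \<tau>)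
  case (Forall a)
  have "subst (push \<sigma>) a = subst (push \<tau>) a"
    by (rule Forall.IH) (use Forall.prems in \<open>auto simp: push_def split: nat.split\<close>)
  then show ?case by simp
next
  case (Exists a)
  have "subst (push \<sigma>) a = subst (push \<tau>) a"
    by (rule Exists.IH) (use Exists.prems in \<open>auto simp: push_def split: nat.split\<close>)
  then show ?case by simp
next
  case (BForall t a)
  have "subst (push \<sigma>) a = subst (push \<tau>) a"
    by (rule BForall.IH) (use BForall.prems in \<open>auto simp: push_def split: nat.split\<close>)
  moreover have "subst_trm \<sigma> t = subst_trm \<tau> t"
    by (rule subst_trm_cong) (use BForall.prems in auto)
  ultimately show ?case by simp
next
  case (BExists t a)
  have "subst (push \<sigma>) a = subst (push \<tau>) a"
    by (rule BExists.IH) (use BExists.prems in \<open>auto simp: push_def split: nat.split\<close>)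
  moreover have "subst_trm \<sigma> t = subst_trm \<tau> t"
    by (rule subst_trm_cong) (use BExists.prems in auto)
  ultimately show ?case by simp
next
  case (Neg a)
  have "subst \<sigma> a = subst \<tau> a" by (rule Neg.IH) (use Neg.prems in auto)
  then show ?case by simp
next
  case (And a b)
  have "subst \<sigma> a = subst \<tau> a" by (rule And.IH(1)) (use And.prems in auto)
  moreover have "subst \<sigma> b = subst \<tau> b" by (rule And.IH(2)) (use And.prems in auto)
  ultimately show ?case by simp
next
  case (Or a b)
  have "subst \<sigma> a = subst \<tau> a" by (rule Or.IH(1)) (use Or.prems in auto)
  moreover have "subst \<sigma> b = subst \<tau> b" by (rule Or.IH(2)) (use Or.prems in auto)
  ultimately show ?case by simp
next
  case (Imp a b)
  have "subst \<sigma> a = subst \<tau> a" by (rule Imp.IH(1)) (use Imp.prems in auto)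
  moreover have "subst \<sigma> b = subst \<tau> b" by (rule Imp.IH(2)) (use Imp.prems in auto)
  ultimately show ?case by simp
qed (auto intro!: subst_trm_cong)

lemma subst_trm_Var: "subst_trm Var t = t"
  by (induction t) (auto intro: map_idI)

lemma subst_trm_closed:
  assumes "fv_trm t = {}"
  shows "subst_trm \<sigma> t = t"
  using subst_trm_cong[of t \<sigma> Var] assms by (simp add: subst_trm_Var)

lemma lift_trm_closed: "fv_trm t = {} \<Longrightarrow> lift_trm t = t"
  by (simp add: lift_trm_def subst_trm_closed)

lemma subst_trm_subst_trm:
  "subst_trm \<sigma> (subst_trm \<tau> t) = subst_trm (\<lambda>i. subst_trm \<sigma> (\<tau> i)) t"
  by (induction t) auto

lemma subst_trm_push: "subst_trm (push \<sigma>) (push \<tau> i) = push (\<lambda>i. subst_trm \<sigma> (\<tau> i)) i"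
  by (cases i) (simp_all add: push_def lift_trm_def subst_trm_subst_trm)

lemma subst_subst: "subst \<sigma> (subst \<tau> a) = subst (\<lambda>i. subst_trm \<sigma> (\<tau> i)) a"
  by (induction a arbitrary: \<sigma> \<tau>) (auto simp: subst_trm_subst_trm subst_trm_push)

lemma fv_subst_trm: "fv_trm (subst_trm \<sigma> t) = (\<Union>i\<in>fv_trm t. fv_trm (\<sigma> i))"
  by (induction t) auto

text \<open>Serves the binder cases of \<open>fv_subst\<close>: \<open>push \<sigma>\<close> sends
  index 0 to \<open>Var 0\<close>, which contributes no successor, so only the shifted images under
  \<sigma> remain.\<close>

lemma Suc_mem_fv_push:
  "(\<exists>i\<in>A. Suc j \<in> fv_trm (push \<sigma> i)) \<longleftrightarrow> (\<exists>i. Suc i \<in> A \<and> j \<in> fv_trm (\<sigma> i))"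
proof -
  have "Suc j \<in> fv_trm (push \<sigma> i) \<longleftrightarrow> (\<exists>k. i = Suc k \<and> j \<in> fv_trm (\<sigma> k))" for i
    by (cases i) (auto simp: push_def lift_trm_def fv_subst_trm)
  then show ?thesis by auto
qed

lemma fv_subst: "fv (subst \<sigma> a) = (\<Union>i\<in>fv a. fv_trm (\<sigma> i))"
  by (induction a arbitrary: \<sigma>) (auto simp: fv_subst_trm Suc_mem_fv_push)

lemma wf_subst_trm: "wf_trm \<xi> t \<Longrightarrow> (\<And>i. wf_trm \<xi> (\<sigma> i)) \<Longrightarrow> wf_trm \<xi> (subst_trm \<sigma> t)"
  by (induction t) (auto simp: list_all_iff)

lemma wf_push: "(\<And>i. wf_trm \<xi> (\<sigma> i)) \<Longrightarrow> wf_trm \<xi> (push \<sigma> i)"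
  by (auto simp: push_def lift_trm_def wf_subst_trm split: nat.split)

lemma wf_subst: "wf_fm \<xi> a \<Longrightarrow> (\<And>i. wf_trm \<xi> (\<sigma> i)) \<Longrightarrow> wf_fm \<xi> (subst \<sigma> a)"
  by (induction a arbitrary: \<sigma>) (auto simp: wf_subst_trm wf_push list_all_iff)

lemma wf_inst: "wf_fm \<xi> a \<Longrightarrow> list_all (wf_trm \<xi>) ts \<Longrightarrow> wf_fm \<xi> (inst a ts)"
  by (auto simp: inst_def list_all_length intro!: wf_subst)

lemma val_subst_trm: "val \<xi> e (subst_trm \<sigma> t) = val \<xi> (\<lambda>i. val \<xi> e (\<sigma> i)) t"
  by (induction t) (auto simp: comp_def cong: map_cong)

text \<open>Semantic counterpart of \<open>push\<close>, for the quantifier cases of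
  \<open>sat_subst\<close>: index 0 reads the bound value, and lifted terms ignore it.\<close>

lemma val_push: "(\<lambda>i. val \<xi> (case_nat v e) (push \<sigma> i)) = case_nat v (\<lambda>i. val \<xi> e (\<sigma> i))"
  by (rule ext) (simp add: push_def lift_trm_def val_subst_trm split: nat.split)

lemma sat_subst: "sat \<xi> e (subst \<sigma> a) = sat \<xi> (\<lambda>i. val \<xi> e (\<sigma> i)) a"
  by (induction a arbitrary: e \<sigma>) (auto simp: val_subst_trm val_push comp_def)

lemma fv_inst:
  "fv a \<subseteq> {..<length ts} \<Longrightarrow> fv (inst a ts) \<subseteq> (\<Union>t\<in>set ts. fv_trm t)"
  by (fastforce simp: inst_def fv_subst)

text \<open>An index beyond the list stays a variable under \<open>inst\<close>, so \<sigma> would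
  act on it on the left but not on the right; the bound on the free variables excludes this.\<close>

lemma subst_inst:
  assumes "fv a \<subseteq> {..<length ts}"
  shows "subst \<sigma> (inst a ts) = inst a (map (subst_trm \<sigma>) ts)"
  unfolding inst_def subst_subst using assms by (intro subst_cong) auto

lemma sat_inst2:
  "defines2 \<xi> a R \<Longrightarrow> sat \<xi> e (inst a [s, t]) \<longleftrightarrow> R (val \<xi> e s) (val \<xi> e t)"
  by (simp add: defines2_def inst_def sat_subst)

lemma sat_inst3:
  "defines3 \<xi> a R \<Longrightarrow>
    sat \<xi> e (inst a [s, t, u]) \<longleftrightarrow> R (val \<xi> e s) (val \<xi> e t) (val \<xi> e u)"
  by (simp add: defines3_def inst_def sat_subst)


section \<open>Recursively enumerable singletons\<close>

text \<open>Prepares the enumerability of singletons, which admits {S} as a theory \<theta> in the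
  stability conditions. \<open>Zero\<close> accepts every argument list, and each further
  \<open>Succ\<close> raises the constant by one.\<close>

lemma ex_recf_const: "\<exists>f. \<forall>xs y. rec_eval f xs y \<longleftrightarrow> y = n"
proof (induction n)
  case 0
  have "rec_eval Zero xs y \<longleftrightarrow> y = 0" for xs y
    by (subst rec_eval.simps) simp
  then show ?case by blast
next
  case (Suc n)
  then obtain f where f: "\<And>xs y. rec_eval f xs y \<longleftrightarrow> y = n" by blast
  have succ: "rec_eval Succ xs y \<longleftrightarrow> (\<exists>x. xs = [x] \<and> y = Suc x)" for xs y
    by (subst rec_eval.simps) auto
  have "rec_eval (Comp Succ [f]) xs y \<longleftrightarrow> y = Suc n" for xs y
    by (subst rec_eval.simps) (auto simp: succ f list_all2_Cons1)
  then show ?case by blast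
qed

lemma rec_enumerable_singleton: "rec_enumerable {n}"
proof -
  obtain f where "\<And>xs y. rec_eval f xs y \<longleftrightarrow> y = n" using ex_recf_const by blast
  then show ?thesis unfolding rec_enumerable_def by (intro exI[of _ f]) auto
qed


section \<open>Fully bounded formulas\<close>

lemma prenex_neg_fully_bounded: "fully_bounded a \<Longrightarrow> prenex_neg a = Neg a"
  by (cases a) auto

lemma scope_fully_bounded: "fully_bounded a \<Longrightarrow> scope t a = a"
  by (cases a) auto

lemma good_fully_bounded: "fully_bounded X \<Longrightarrow> good \<xi> N X \<longleftrightarrow> true_std \<xi> X"
  by (cases N) (simp_all add: good_def scope_fully_bounded)

lemma Delta0_subset_Pi_class: "Delta0 \<xi> \<subseteq> Pi_class \<xi> 1"
  \<comment> \<open>A block of quantifiers may be empty.\<close>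
  by (auto intro!: exI[of _ "0::nat"])

lemma Delta0_subset_Sigma_class: "Delta0 \<xi> \<subseteq> Sigma_class \<xi> 1"
  by (auto intro!: exI[of _ "0::nat"])

lemma zero_stableI:
  assumes "Delta0_class \<xi>" and "zero_stable \<xi> \<or> E_stable \<xi> \<or> A_stable \<xi>"
  shows "zero_stable \<xi>"
proof -
  have bounded: "fully_bounded X" if "X \<in> Delta0 \<xi>" for X
    using assms(1) that by (auto simp: Delta0_class_def)
  have "zero_stable \<xi>" if "E_stable \<xi>"
    using that Delta0_subset_Sigma_class[of \<xi>] good_fully_bounded[OF bounded]
    unfolding E_stable_def zero_stable_def by blast
  moreover have "zero_stable \<xi>" if "A_stable \<xi>"
    using that Delta0_subset_Pi_class[of \<xi>] good_fully_bounded[OF bounded]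
    unfolding A_stable_def zero_stable_def by blast
  ultimately show ?thesis using assms(2) by blast
qed


section \<open>Self-consistency\<close>

text \<open>The diagonal step: \<open>self_subst\<close> puts the numeral for every variable,
  \<open>inst\<close> only for index 0, and these agree when no other index is free. Hence the
  sentence that \<open>subst_prf\<close> adds at the code of \<open>Gamma_fm N P\<close> is
  \<open>SelfCons\<close> itself.\<close>

lemma self_subst_Gamma_fm:
  assumes "fv (Gamma_fm N P) \<subseteq> {0}"
  shows "self_subst \<xi> (Gamma_fm N P) = SelfCons \<xi> N P"
  unfolding self_subst_def SelfCons_def inst_def using assms by (intro subst_cong) auto

text \<open>Fixing the first argument of P to the numeral yields a proof formula Q with which the
  self-consistency sentence has literally the shape that \<open>states_consistency\<close>
  demands.\<close>

lemma SelfCons_eq: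
  assumes "language \<xi>" "fv N \<subseteq> {0, 1}" "fv P \<subseteq> {0, 1, 2}"
    and "Q = inst P [numeral \<xi> (code_fm \<xi> (Gamma_fm N P)), Var 0, Var 1]"
  shows "SelfCons \<xi> N P = Forall (Forall (Forall (Forall (Neg
       (And (inst N [Var 3, Var 2])
            (And (inst Q [Var 3, Var 1])
                 (inst Q [Var 2, Var 0])))))))"
proof -
  define c where "c = numeral \<xi> (code_fm \<xi> (Gamma_fm N P))"
  have c: "fv_trm c = {}" using assms(1) by (simp add: c_def language_def)
  have fvN: "fv N \<subseteq> {..<length [s, t]}" for s t :: "'a trm" using assms(2) by auto
  have fvP: "fv P \<subseteq> {..<length [s, t, u]}" for s t u :: "'a trm" using assms(3) by auto
  have Q: "inst Q [s, t] = inst P [c, s, t]" for s t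
  proof -
    \<comment> \<open>Only the outer \<open>inst\<close> is unfolded, so that
      \<open>subst_inst\<close> can merge it with the inner one.\<close>
    have "inst Q [s, t] = subst (\<lambda>i. if i < length [s, t] then [s, t] ! i else Var i)
        (inst P [c, Var 0, Var 1])"
      unfolding c_def assms(4)[symmetric] by (rule inst_def)
    then show ?thesis by (simp add: subst_inst[OF fvP] subst_trm_closed[OF c])
  qed
  \<comment> \<open>Under the four quantifiers the substitution fixes the indices 0 to 3 and sends 4
    to c, which is closed and so survives the lifting.\<close>
  show ?thesis
    unfolding Q SelfCons_def inst_def[of "Gamma_fm N P"] c_def[symmetric]
    by (simp add: Gamma_fm_def subst_inst[OF fvN] subst_inst[OF fvP] push_def eval_nat_numeral
        lift_trm_closed[OF c]) (simp add: lift_trm_def)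
qed

text \<open>Self-reference becomes exact because \<open>code_fm\<close> is injective on well-formed
  formulas: the code of \<Gamma> determines the formula sought in \<open>subst_prf\<close>, so Q
  speaks of proofs from \<beta> together with \<open>SelfCons\<close>.\<close>

lemma
  fixes \<xi> :: "('f, 'r, 'p) config" and N P :: "('f, 'r) fm"
  assumes "language \<xi>" "encoding \<xi>"
    and N: "defines2 \<xi> N (neg_pair \<xi> 0)" and P: "defines3 \<xi> P (subst_prf \<xi> \<beta>)"
  shows sentence_SelfCons: "sentence \<xi> (SelfCons \<xi> N P)"
    and defines_prf_code: "defines2 \<xi> (inst P [numeral \<xi> (code_fm \<xi> (Gamma_fm N P)), Var 0, Var 1])
      (prf_code \<xi> (\<beta> \<union> {SelfCons \<xi> N P}))"
proof -
  define \<Gamma> where "\<Gamma> = Gamma_fm N P"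
  define c where "c = numeral \<xi> (code_fm \<xi> \<Gamma>)"
  have c: "wf_trm \<xi> c" "fv_trm c = {}" "\<And>e. val \<xi> e c = code_fm \<xi> \<Gamma>"
    using assms(1) by (auto simp: language_def c_def)
  have wf: "wf_fm \<xi> N" "wf_fm \<xi> P" and fv: "fv N \<subseteq> {0, 1}" "fv P \<subseteq> {0, 1, 2}"
    using N P by (simp_all add: defines2_def defines3_def)
  have fvN: "fv (inst N [s, t]) \<subseteq> fv_trm s \<union> fv_trm t" for s t
    using fv_inst[of N "[s, t]"] fv(1) by auto
  have fvP: "fv (inst P [s, t, u]) \<subseteq> fv_trm s \<union> fv_trm t \<union> fv_trm u" for s t u
  proof -
    have "fv P \<subseteq> {..<length [s, t, u]}" using fv(2) by auto
    from fv_inst[OF this] show ?thesis by auto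
  qed
  have wf\<Gamma>: "wf_fm \<xi> \<Gamma>" by (simp add: \<Gamma>_def Gamma_fm_def wf wf_inst)
  have fv\<Gamma>: "fv \<Gamma> \<subseteq> {0}"
    using fvN[of "Var 3" "Var 2"] fvP[of "Var 4" "Var 3" "Var 1"] fvP[of "Var 4" "Var 2" "Var 0"]
    by (auto simp: \<Gamma>_def Gamma_fm_def)
  have SC: "SelfCons \<xi> N P = inst \<Gamma> [c]"
    by (simp add: SelfCons_def c_def \<Gamma>_def)
  have "fv (inst \<Gamma> [c]) \<subseteq> {}"
    using fv_inst[of \<Gamma> "[c]"] fv\<Gamma> c(2) by auto
  moreover have "wf_fm \<xi> (inst \<Gamma> [c])"
    using wf\<Gamma> c(1) by (simp add: wf_inst)
  ultimately show "sentence \<xi> (SelfCons \<xi> N P)" by (simp add: sentence_def SC)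
  have "subst_prf \<xi> \<beta> (code_fm \<xi> \<Gamma>) t p \<longleftrightarrow> prf_code \<xi> (\<beta> \<union> {SelfCons \<xi> N P}) t p" for t p
  proof -
    have "a = \<Gamma>" if "wf_fm \<xi> a" "code_fm \<xi> \<Gamma> = code_fm \<xi> a" for a
      using assms(2) wf\<Gamma> that by (auto simp: encoding_def inj_on_def)
    then show ?thesis
      using wf\<Gamma> self_subst_Gamma_fm[OF fv\<Gamma>[unfolded \<Gamma>_def], of \<xi>]
      unfolding subst_prf_def \<Gamma>_def by metis
  qed
  then show "defines2 \<xi> (inst P [numeral \<xi> (code_fm \<xi> (Gamma_fm N P)), Var 0, Var 1])
      (prf_code \<xi> (\<beta> \<union> {SelfCons \<xi> N P}))"
    using fvP[of c "Var 0" "Var 1"] c wf wf_inst[of \<xi> P "[c, Var 0, Var 1]"]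
    by (auto simp: defines2_def sat_inst3[OF P] simp flip: c_def \<Gamma>_def)
qed

theorem theorem5p11:
  fixes \<xi> :: "('f, 'r, 'p) config" and N P :: "('f, 'r) fm"
  assumes "generic_configuration \<xi>"
    and "selfcons_formulas \<xi> 0 (base \<xi>) N P"
    and "zero_stable \<xi> \<or> E_stable \<xi> \<or> A_stable \<xi>"
  shows "self_justifying \<xi> 0 N
    (inst P [numeral \<xi> (code_fm \<xi> (Gamma_fm N P)), Var 0, Var 1])
    (base \<xi> \<union> {SelfCons \<xi> N P})"
proof -
  define S where "S = SelfCons \<xi> N P"
  define Q where "Q = inst P [numeral \<xi> (code_fm \<xi> (Gamma_fm N P)), Var 0, Var 1]"
  define \<alpha> where "\<alpha> = base \<xi> \<union> {S}"
  have lang: "language \<xi>" and D0: "Delta0_class \<xi>" and base: "base_system \<xi>"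
    and ded: "deduction_method \<xi>" and enc: "encoding \<xi>"
    using assms(1) by (simp_all add: generic_configuration_def)
  have N: "defines2 \<xi> N (neg_pair \<xi> 0)" and P: "defines3 \<xi> P (subst_prf \<xi> (base \<xi>))"
    and S_Pi: "S \<in> Pi_class \<xi> 1"
    using assms(2) by (simp_all add: selfcons_formulas_def S_def)
  have S_eq: "S = Forall (Forall (Forall (Forall (Neg
       (And (inst N [Var 3, Var 2])
            (And (inst Q [Var 3, Var 1])
                 (inst Q [Var 2, Var 0])))))))"
    unfolding S_def
    by (rule SelfCons_eq[OF lang]) (use N P in \<open>auto simp: defines2_def defines3_def Q_def\<close>)
  have S_sent: "sentence \<xi> S"
    unfolding S_def by (rule sentence_SelfCons[OF lang enc N P])
  have Q: "defines2 \<xi> Q (prf_code \<xi> \<alpha>)"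
    unfolding Q_def \<alpha>_def S_def by (rule defines_prf_code[OF lang enc N P])
  have \<alpha>_sent: "\<forall>X\<in>\<alpha>. sentence \<xi> X"
    using base S_sent by (auto simp: base_system_def \<alpha>_def)
  have "provable \<xi> \<alpha> S"
    using ded \<alpha>_sent by (auto simp: deduction_method_def \<alpha>_def)
  moreover have "states_consistency \<xi> 0 N Q \<alpha> S"
    unfolding states_consistency_def using N Q S_eq by blast
  moreover have "consistent \<xi> \<alpha>"
  proof -
    define bad where "bad = (\<lambda>x y p q. neg_pair \<xi> 0 x y \<and> prf_code \<xi> \<alpha> x p \<and> prf_code \<xi> \<alpha> y q)"
    \<comment> \<open>All four components are bounded, not only the proofs p and q, because
      \<open>scope\<close> restricts all four quantifiers of S.\<close>
    define bad_at where
      "bad_at = (\<lambda>m. \<exists>x y p q. bad x y p q \<and> x \<le> m \<and> y \<le> m \<and> p \<le> m \<and> q \<le> m)"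
    have sat_S: "sat \<xi> e S \<longleftrightarrow> (\<forall>x y p q. \<not> bad x y p q)" for e
      unfolding S_eq by (simp add: sat_inst2[OF N] sat_inst2[OF Q] bad_def eval_nat_numeral)
    \<comment> \<open>The relativised quantifiers range below b, and four numbers below b have their
      maximum below b.\<close>
    have sat_scope: "sat \<xi> e (scope (numeral \<xi> b) S)" if "\<And>m. m < b \<Longrightarrow> \<not> bad_at m" for b e
    proof -
      have "\<not> bad x y p q" if *: "x < b" "y < b" "p < b" "q < b" for x y p q
      proof -
        have "max (max x y) (max p q) < b" using * by simp
        from \<open>\<And>m. m < b \<Longrightarrow> \<not> bad_at m\<close>[OF this] show ?thesis
          unfolding bad_at_def by (meson max.cobounded1 max.cobounded2 order_trans)
      qed
      \<comment> \<open>\<open>scope\<close> lifts its bound at each quantifier; a closed numeral is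
        unaffected.\<close>
      moreover have "lift_trm (numeral \<xi> b) = numeral \<xi> b" and "val \<xi> e (numeral \<xi> b) = b" for e
        using lang by (auto simp: language_def lift_trm_closed)
      ultimately show ?thesis
        unfolding S_eq
        by (auto simp: sat_inst2[OF N] sat_inst2[OF Q] eval_nat_numeral not_le bad_def)
          (metis nat_less_le)
    qed
    have "\<not> bad x0 y0 p0 q0" for x0 y0 p0 q0
    proof
      assume "bad x0 y0 p0 q0"
      then have "bad_at (max (max x0 y0) (max p0 q0))"
        unfolding bad_at_def by (meson max.cobounded1 max.cobounded2 order_trans)
      then obtain m where "bad_at m" and least: "\<And>k. k < m \<Longrightarrow> \<not> bad_at k"
        by (metis exists_least_iff)
      then obtain x y p q where b: "bad x y p q" and le: "x \<le> m" "y \<le> m" "p \<le> m" "q \<le> m"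
        by (auto simp: bad_at_def)
      from b obtain X where X: "X \<in> Delta0 \<xi>" "sentence \<xi> X" "x = code_fm \<xi> X"
        "y = code_fm \<xi> (prenex_neg X)"
        by (auto simp: bad_def neg_pair_def)
      have X': "wf_fm \<xi> X" "fully_bounded X" "Neg X \<in> Delta0 \<xi>"
        using D0 X(1) by (auto simp: Delta0_class_def)
      have nX: "sentence \<xi> (Neg X)" using X(2) by (simp add: sentence_def)
      have y: "y = code_fm \<xi> (Neg X)" using X(4) X'(2) by (simp add: prenex_neg_fully_bounded)
      \<comment> \<open>\<open>prf_code\<close> sees sentences only through their codes; injectivity
        turns p and q into proofs of X and \<open>Neg X\<close> themselves.\<close>
      have inj: "A = B" if "sentence \<xi> A" "sentence \<xi> B" "code_fm \<xi> A = code_fm \<xi> B" for A B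
        using enc that by (auto simp: encoding_def inj_on_def sentence_def)
      have proofs: "proof_of \<xi> ({S} \<union> base \<xi>) X p" "proof_of \<xi> ({S} \<union> base \<xi>) (Neg X) q"
        using b inj X(2,3) nX y by (auto simp: bad_def prf_code_def \<alpha>_def)
      \<comment> \<open>Distinct codes cannot both be 0, so m is positive, which gives J \<ge> 0 and
        2^J \<le> m.\<close>
      have "X \<noteq> Neg X" by (induction X) auto
      then have "x \<noteq> y" using inj X(2,3) nX y by metis
      then have m: "m \<ge> 1" using le by linarith
      \<comment> \<open>Thus 2^J \<le> m < 2^(J+1). By minimality of m, the lower bound makes S
        Good(J); the upper bound keeps the logarithms of p and q within J + 1, exactly the slack
        that stability grants.\<close>
      define J where "J = \<lfloor>log 2 (real m)\<rfloor>"
      have J0: "J \<ge> 0" using m by (simp add: J_def)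
      have "2 powr real_of_int J \<le> 2 powr log 2 (real m)"
        by (rule powr_mono) (auto simp: J_def)
      then have E_le: "nat \<lceil>2 powr real_of_int J\<rceil> \<le> m" using m by (simp add: ceiling_le_iff)
      have "good \<xi> (ereal (real_of_int J)) S"
        by (auto simp: good_def true_std_def E_term_def
            intro!: sat_scope least[OF less_le_trans[OF _ E_le]])
      then have "ereal (real_of_int J) \<le> sharp \<xi> {S}"
        unfolding sharp_def by (intro Sup_upper) auto
      then have sharp: "ereal (real_of_int J) + 1 \<le> sharp \<xi> {S} + 1"
        by (rule add_right_mono)
      have log: "ereal (log 2 (real n)) \<le> sharp \<xi> {S} + 1" if "n \<le> m" for n
      proof -
        have "log 2 (real n) \<le> real_of_int J + 1"
        proof (cases "n = 0")
          case True
          \<comment> \<open>junk value: \<open>log 2 0 = 0\<close>\<close>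
          then show ?thesis using J0 by (simp add: log_def)
        next
          case False
          then have "log 2 (real n) \<le> log 2 (real m)" using that by simp
          then show ?thesis unfolding J_def by linarith
        qed
        then have "ereal (log 2 (real n)) \<le> ereal (real_of_int J) + 1"
          by (simp add: one_ereal_def)
        then show ?thesis using sharp by (rule order_trans)
      qed
      have "{S} \<in> RE_Class \<xi>"
        using S_Pi S_sent by (simp add: RE_Class_def rec_enumerable_singleton)
      moreover have "zero_stable \<xi>" using D0 assms(3) by (rule zero_stableI)
      ultimately have "true_std \<xi> X" "true_std \<xi> (Neg X)"
        using X(1,2) X'(3) nX proofs log[OF le(3)] log[OF le(4)] unfolding zero_stable_def by blast+
      then show False by (simp add: true_std_def)
    qed
    then have "\<forall>Y\<in>\<alpha>. true_std \<xi> Y"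
      using base sat_S by (auto simp: base_system_def \<alpha>_def true_std_def)
    then have "true_std \<xi> X" if "sentence \<xi> X" "provable \<xi> \<alpha> X" for X
      using ded \<alpha>_sent that unfolding deduction_method_def by blast
    moreover have "sentence \<xi> (Neg X)" if "sentence \<xi> X" for X
      using that by (simp add: sentence_def)
    ultimately show ?thesis
      unfolding consistent_def true_std_def by (metis sat.simps(4))
  qed
  ultimately show ?thesis
    unfolding self_justifying_def Q_def[symmetric] S_def[symmetric] \<alpha>_def[symmetric] by blast
qed

end
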